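(* Let $2\le p\le n$. Then $$\mathrm{rank}\, RSS_n(p)=\mathrm{idrank}\, RSS_n(p)=|E(RSS_n(p)\setminus\{0\})|=\binom{n-1}{p-1}2^{n-p}.$$
   Context: Let $[n]=\{1,2,\ldots,n\}$ with its usual order. A partial transformation of $[n]$ is a map $\alpha$ whose domain $\mathrm{Dom}\,\alpha$ and image $\mathrm{Im}\,\alpha$ are subsets of $[n]$; maps are written on the right and composed left to right: $x(\alpha\beta)=(x\alpha)\beta$. $\alpha$ is isotone if $x\le y$ implies $x\alpha\le y\alpha$ for all $x,y\in\mathrm{Dom}\,\alpha$, and order-decreasing if $x\alpha\le x$ for all $x\in\mathrm{Dom}\,\alpha$. $\mathcal{SS}_n$ is the semigroup of all isotone order-decreasing partial transformations $\alpha$ of $[n]$ with $1\in\mathrm{Dom}\,\alpha$. For $1\le p\le n$, $M(n,p)=\{\alpha\in\mathcal{SS}_n: |\mathrm{Im}\,\alpha|\le p\}$ is a two-sided ideal of $\mathcal{SS}_n$, and for $p\ge2$, $RSS_n(p)=M(n,p)/M(n,p-1)$ is the Rees quotient semigroup: its nonzero elements are the $\alpha\in\mathcal{SS}_n$ with $|\mathrm{Im}\,\alpha|=p$, and the product of two nonzero elements is their composite if it has image of size $p$, and $0$ otherwise. $E(RSS_n(p)\setminus\{0\})$ is the set of nonzero idempotents of $RSS_n(p)$. For a finite semigroup $S$, $\mathrm{rank}(S)$ is the minimum cardinality of a subset $A\subseteq S$ with $\langle A\rangle=S$ (subsemigroup generated by $A$), and $\mathrm{idrank}(S)$ is the minimum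 cardinality of such an $A$ consisting of idempotents.
   Formalization: For p=n the claim fails literally: RSS_n(n)={0,1} has rank and idrank 2, while the formula gives 1; so the rank and idrank equalities are stated literally only for p<n, and for all 2≤p≤n with the zero not counted as a generator. *)

theory Defs
  imports Complex_Main "HOL-Library.Extended_Nat"
begin

section \<open>Rank and idempotent rank\<close>

inductive_set subsemigroup_generated :: "('a \<Rightarrow> 'a \<Rightarrow> 'a) \<Rightarrow> 'a set \<Rightarrow> 'a set"
  for mult :: "'a \<Rightarrow> 'a \<Rightarrow> 'a" and A :: "'a set" where
  base: "a \<in> A \<Longrightarrow> a \<in> subsemigroup_generated mult A"
| mult: "x \<in> subsemigroup_generated mult A \<Longrightarrow> y \<in> subsemigroup_generated mult A
         \<Longrightarrow> mult x y \<in> subsemigroup_generated mult A"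

definition idempotents :: "('a \<Rightarrow> 'a \<Rightarrow> 'a) \<Rightarrow> 'a set \<Rightarrow> 'a set" where
  "idempotents mult S = {x \<in> S. mult x x = x}"

text \<open>The minima are taken in \<^typ>\<open>enat\<close>, so that the value is \<open>\<infinity>\<close> when there is no finite
  generating set of the required kind.\<close>

definition semigroup_rank :: "('a \<Rightarrow> 'a \<Rightarrow> 'a) \<Rightarrow> 'a set \<Rightarrow> enat" where
  "semigroup_rank mult S =
     (INF A \<in> {A. finite A \<and> A \<subseteq> S \<and> subsemigroup_generated mult A = S}. enat (card A))"

definition semigroup_idrank :: "('a \<Rightarrow> 'a \<Rightarrow> 'a) \<Rightarrow> 'a set \<Rightarrow> enat" where
  "semigroup_idrank mult S =
     (INF A \<in> {A. finite A \<and> A \<subseteq> idempotents mult S \<and> subsemigroup_generated mult A = S}.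
        enat (card A))"

text \<open>The same invariants for \<open>S\<close> regarded as a semigroup with zero \<open>z\<close>: the zero is available
  for free and is not counted as a generator.\<close>

definition semigroup0_rank :: "('a \<Rightarrow> 'a \<Rightarrow> 'a) \<Rightarrow> 'a \<Rightarrow> 'a set \<Rightarrow> enat" where
  "semigroup0_rank mult z S =
     (INF A \<in> {A. finite A \<and> A \<subseteq> S \<and> subsemigroup_generated mult (insert z A) = S}.
        enat (card A))"

definition semigroup0_idrank :: "('a \<Rightarrow> 'a \<Rightarrow> 'a) \<Rightarrow> 'a \<Rightarrow> 'a set \<Rightarrow> enat" where
  "semigroup0_idrank mult z S =
     (INF A \<in> {A. finite A \<and> A \<subseteq> idempotents mult S
                    \<and> subsemigroup_generated mult (insert z A) = S}.
        enat (card A))"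


section \<open>Rees quotients\<close>

datatype 'a rees = Zero | Nonzero 'a

definition rees_quotient :: "'a set \<Rightarrow> 'a set \<Rightarrow> 'a rees set" where
  "rees_quotient S I = insert Zero (Nonzero ` (S - I))"

fun rees_mult :: "('a \<Rightarrow> 'a \<Rightarrow> 'a) \<Rightarrow> 'a set \<Rightarrow> 'a rees \<Rightarrow> 'a rees \<Rightarrow> 'a rees" where
  "rees_mult mult I (Nonzero x) (Nonzero y) =
     (if mult x y \<in> I then Zero else Nonzero (mult x y))"
| "rees_mult mult I _ _ = Zero"


section \<open>The semigroups of partial transformations\<close>

type_synonym ptrans = "nat \<rightharpoonup> nat"

text \<open>Maps act on the right, so \<open>ptrans_mult \<alpha> \<beta>\<close> applies \<open>\<alpha>\<close> first.\<close>

definition ptrans_mult :: "ptrans \<Rightarrow> ptrans \<Rightarrow> ptrans" where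
  "ptrans_mult \<alpha> \<beta> = \<beta> \<circ>\<^sub>m \<alpha>"

definition isotone :: "ptrans \<Rightarrow> bool" where
  "isotone \<alpha> \<longleftrightarrow> (\<forall>x \<in> dom \<alpha>. \<forall>y \<in> dom \<alpha>. x \<le> y \<longrightarrow> the (\<alpha> x) \<le> the (\<alpha> y))"

definition order_decreasing :: "ptrans \<Rightarrow> bool" where
  "order_decreasing \<alpha> \<longleftrightarrow> (\<forall>x \<in> dom \<alpha>. the (\<alpha> x) \<le> x)"

definition SS :: "nat \<Rightarrow> ptrans set" where
  "SS n = {\<alpha>. dom \<alpha> \<subseteq> {1..n} \<and> ran \<alpha> \<subseteq> {1..n} \<and> isotone \<alpha> \<and> order_decreasing \<alpha> \<and> 1 \<in> dom \<alpha>}"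

definition M :: "nat \<Rightarrow> nat \<Rightarrow> ptrans set" where
  "M n p = {\<alpha> \<in> SS n. card (ran \<alpha>) \<le> p}"

definition RSS :: "nat \<Rightarrow> nat \<Rightarrow> ptrans rees set" where
  "RSS n p = rees_quotient (M n p) (M n (p - 1))"

definition RSS_mult :: "nat \<Rightarrow> nat \<Rightarrow> ptrans rees \<Rightarrow> ptrans rees \<Rightarrow> ptrans rees" where
  "RSS_mult n p = rees_mult ptrans_mult (M n (p - 1))"

text \<open>For \<open>p < n\<close> the rank and idempotent rank of \<open>RSS n p\<close> can be taken among all
  subsemigroup generating sets. For \<open>p = n\<close> the only nonzero element is the identity map, so
  \<open>RSS n n\<close> is a two-element semigroup \<open>{0, 1}\<close> whose rank as a plain semigroup is 2, whereas
  it has a single nonzero idempotent; there the formula for the rank refers to \<open>RSS n n\<close> as a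
  semigroup with zero.\<close>

end

theory Submission
  imports Defs
begin

text \<open>
  An idempotent of \<open>SS n\<close> rounds each point of its domain \<open>D\<close> down to its image \<open>A \<subseteq> D\<close>, so the
  idempotents with image of size \<open>p\<close> correspond to pairs \<open>1 \<in> A \<subseteq> D \<subseteq> {1..n}\<close> with \<open>card A = p\<close>,
  which gives the count. If such an idempotent \<open>e\<close> is a product \<open>\<beta>\<gamma>\<close> of elements with images of
  size \<open>p\<close>, then \<open>\<beta>\<close> has the same domain and kernel as \<open>e\<close>, and \<open>a = a\<beta>\<gamma> \<le> a\<beta> \<le> a\<close> for \<open>a\<close> in
  the image of \<open>e\<close>, so \<open>\<beta> = e\<close>. Hence every generating set contains all nonzero idempotents.
  Conversely, these generate: if \<open>x\<close> is the least non-fixed point among the minima \<open>A\<close> of the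
  kernel classes of \<open>\<alpha>\<close>, then \<open>\<alpha>\<close> is the product of the idempotent rounding down to \<open>A\<close>, an
  idempotent moving only \<open>x\<close> to \<open>x\<alpha>\<close>, and an element whose domain has a smaller sum.
\<close>

text \<open>The \<open>Max\<close> ranges over a nonempty set once \<open>1 \<in> A\<close> and
  \<open>1 \<le> x\<close>; the bound \<open>a \<le> x\<close> keeps that set finite for every
  \<open>A\<close>.\<close>

definition retract :: "nat set \<Rightarrow> nat set \<Rightarrow> ptrans" where
  "retract A D = (\<lambda>x. if x \<in> D then Some (Max {a \<in> A. a \<le> x}) else None)"

definition rank_layer :: "nat \<Rightarrow> nat \<Rightarrow> ptrans set" where
  "rank_layer n p = {\<alpha> \<in> SS n. card (ran \<alpha>) = p}"

text \<open>\<open>A\<close> plays the image and \<open>D\<close> the domain of an idempotent; the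
  dependent sum turns the count into a sum over images.\<close>

definition retract_pairs :: "nat \<Rightarrow> nat \<Rightarrow> (nat set \<times> nat set) set" where
  "retract_pairs n p =
     (SIGMA A:{A. 1 \<in> A \<and> A \<subseteq> {1..n} \<and> card A = p}. {D. A \<subseteq> D \<and> D \<subseteq> {1..n}})"

section \<open>Composition\<close>

lemma ptrans_mult_apply:
  "ptrans_mult \<alpha> \<beta> x = (case \<alpha> x of None \<Rightarrow> None | Some y \<Rightarrow> \<beta> y)"
  by (simp add: ptrans_mult_def map_comp_def)

lemma ptrans_mult_SomeE:
  assumes "ptrans_mult \<alpha> \<beta> x = Some z"
  obtains y where "\<alpha> x = Some y" "\<beta> y = Some z"
  using assms by (auto simp: ptrans_mult_apply split: option.splits)

text \<open>A pointwise form that avoids \<open>the\<close>, \<open>dom\<close> and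
  \<open>ran\<close> in later arguments. The last conjunct sharpens
  \<open>1 \<in> dom \<alpha>\<close>: the value at 1 is at least 1 and, by order-decrease, at most
  1.\<close>

lemma SS_iff:
  "\<alpha> \<in> SS n \<longleftrightarrow>
     (\<forall>x y. \<alpha> x = Some y \<longrightarrow> 1 \<le> y \<and> y \<le> x \<and> x \<le> n) \<and>
     (\<forall>x x' y y'. \<alpha> x = Some y \<longrightarrow> \<alpha> x' = Some y' \<longrightarrow> x \<le> x' \<longrightarrow> y \<le> y') \<and>
     \<alpha> 1 = Some 1"
  (is "?L \<longleftrightarrow> ?R")
proof
  assume L: ?L
  have b: "1 \<le> y \<and> y \<le> x \<and> x \<le> n" if "\<alpha> x = Some y" for x y
    using L that unfolding SS_def order_decreasing_def by (force simp: ran_def dom_def)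
  moreover have "\<forall>x x' y y'. \<alpha> x = Some y \<longrightarrow> \<alpha> x' = Some y' \<longrightarrow> x \<le> x' \<longrightarrow> y \<le> y'"
    using L unfolding SS_def isotone_def by (force simp: dom_def)
  moreover obtain y where "\<alpha> 1 = Some y"
    using L unfolding SS_def by auto
  with b have "\<alpha> 1 = Some 1"
    by (metis le_antisym)
  ultimately show ?R
    by blast
next
  assume R: ?R
  show ?L
    unfolding SS_def isotone_def order_decreasing_def
    using R by (fastforce simp: ran_def dom_def)
qed

lemma SS_bounds:
  assumes "\<alpha> \<in> SS n" "\<alpha> x = Some y"
  shows "1 \<le> y" "y \<le> x" "x \<le> n"
  using assms unfolding SS_iff by blast+

lemma SS_mono:
  assumes "\<alpha> \<in> SS n" "\<alpha> x = Some y" "\<alpha> x' = Some y'" "x \<le> x'"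
  shows "y \<le> y'"
  using assms unfolding SS_iff by blast

lemma SS_one: "\<alpha> \<in> SS n \<Longrightarrow> \<alpha> 1 = Some 1"
  unfolding SS_iff by blast

lemma finite_dom_SS: "\<alpha> \<in> SS n \<Longrightarrow> finite (dom \<alpha>)"
  unfolding SS_def by (auto intro: finite_subset)

lemma finite_ran_SS: "\<alpha> \<in> SS n \<Longrightarrow> finite (ran \<alpha>)"
  unfolding SS_def by (auto intro: finite_subset)

lemma ptrans_mult_SS:
  assumes a: "\<alpha> \<in> SS n" and b: "\<beta> \<in> SS n"
  shows "ptrans_mult \<alpha> \<beta> \<in> SS n"
  unfolding SS_iff
proof (intro conjI allI impI)
  fix x y assume "ptrans_mult \<alpha> \<beta> x = Some y"
  then obtain u where u: "\<alpha> x = Some u" "\<beta> u = Some y"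
    by (rule ptrans_mult_SomeE)
  show "1 \<le> y" "y \<le> x" "x \<le> n"
    using SS_bounds[OF a u(1)] SS_bounds[OF b u(2)] by auto
next
  fix x x' y y'
  assume 1: "ptrans_mult \<alpha> \<beta> x = Some y" and 2: "ptrans_mult \<alpha> \<beta> x' = Some y'" and "x \<le> x'"
  obtain u where u: "\<alpha> x = Some u" "\<beta> u = Some y"
    using 1 by (rule ptrans_mult_SomeE)
  obtain u' where u': "\<alpha> x' = Some u'" "\<beta> u' = Some y'"
    using 2 by (rule ptrans_mult_SomeE)
  show "y \<le> y'"
    using SS_mono[OF a u(1) u'(1) \<open>x \<le> x'\<close>] SS_mono[OF b u(2) u'(2)] by blast
next
  show "ptrans_mult \<alpha> \<beta> 1 = Some 1"
    using SS_one[OF a] SS_one[OF b] by (simp add: ptrans_mult_apply)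
qed

lemma ran_ptrans_mult_subset: "ran (ptrans_mult \<alpha> \<beta>) \<subseteq> ran \<beta>"
  unfolding ran_def by (auto elim: ptrans_mult_SomeE)

section \<open>Idempotents\<close>

lemma Max_below:
  fixes A :: "nat set"
  assumes "1 \<in> A" "1 \<le> x"
  shows Max_below_mem: "Max {a \<in> A. a \<le> x} \<in> A"
    and Max_below_le: "Max {a \<in> A. a \<le> x} \<le> x"
    and Max_below_ge: "\<And>a. a \<in> A \<Longrightarrow> a \<le> x \<Longrightarrow> a \<le> Max {a \<in> A. a \<le> x}"
proof -
  have fin: "finite {a \<in> A. a \<le> x}"
    by (rule finite_subset[of _ "{..x}"]) auto
  have "{a \<in> A. a \<le> x} \<noteq> {}"
    using assms by blast
  then have "Max {a \<in> A. a \<le> x} \<in> {a \<in> A. a \<le> x}"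
    by (rule Max_in[OF fin])
  then show "Max {a \<in> A. a \<le> x} \<in> A" "Max {a \<in> A. a \<le> x} \<le> x"
    by auto
  show "\<And>a. a \<in> A \<Longrightarrow> a \<le> x \<Longrightarrow> a \<le> Max {a \<in> A. a \<le> x}"
    using fin by simp
qed

lemma retract_eq_SomeI:
  assumes "x \<in> D" "a \<in> A" "a \<le> x" "\<And>b. b \<in> A \<Longrightarrow> b \<le> x \<Longrightarrow> b \<le> a"
  shows "retract A D x = Some a"
proof -
  have "finite {a \<in> A. a \<le> x}"
    by (rule finite_subset[of _ "{..x}"]) auto
  then have "Max {a \<in> A. a \<le> x} = a"
    using assms by (intro Max_eqI) auto
  then show ?thesis
    using assms by (simp add: retract_def)
qed

lemma retract_fixes: "a \<in> A \<Longrightarrow> a \<in> D \<Longrightarrow> retract A D a = Some a"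
  by (rule retract_eq_SomeI) auto

lemma dom_retract: "dom (retract A D) = D"
  by (auto simp: retract_def dom_def)

lemma ran_retract:
  assumes "1 \<in> A" "A \<subseteq> D" "D \<subseteq> {1..n}"
  shows "ran (retract A D) = A"
proof
  show "ran (retract A D) \<subseteq> A"
    using assms Max_below_mem[OF assms(1)] by (auto simp: ran_def retract_def split: if_splits)
  show "A \<subseteq> ran (retract A D)"
    using assms(2) retract_fixes by (blast intro: ranI)
qed

lemma retract_SS:
  assumes "1 \<in> A" "A \<subseteq> D" "D \<subseteq> {1..n}"
  shows "retract A D \<in> SS n"
  unfolding SS_iff
proof (intro conjI allI impI)
  fix x y assume xy: "retract A D x = Some y"
  then have x: "x \<in> D" and y: "y = Max {a \<in> A. a \<le> x}"
    by (auto simp: retract_def split: if_splits)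
  have "1 \<le> x" "x \<le> n"
    using x assms by auto
  then show "1 \<le> y" "y \<le> x" "x \<le> n"
    unfolding y using Max_below_ge[OF assms(1), of x 1] Max_below_le[OF assms(1)] assms(1) by auto
next
  fix x x' y y'
  assume 1: "retract A D x = Some y" "retract A D x' = Some y'" and le: "x \<le> x'"
  then have x: "x \<in> D" "x' \<in> D" and y: "y = Max {a \<in> A. a \<le> x}" "y' = Max {a \<in> A. a \<le> x'}"
    by (auto simp: retract_def split: if_splits)
  have "1 \<le> x"
    using x assms by auto
  then show "y \<le> y'"
    unfolding y using Max_below_ge[OF assms(1), of x'] Max_below_le[OF assms(1), of x]
      Max_below_mem[OF assms(1), of x] le by auto
next
  show "retract A D 1 = Some 1"
    using assms by (intro retract_fixes) auto
qed

lemma retract_idem: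
  assumes "1 \<in> A" "A \<subseteq> D" "D \<subseteq> {1..n}"
  shows "ptrans_mult (retract A D) (retract A D) = retract A D"
proof
  fix x
  show "ptrans_mult (retract A D) (retract A D) x = retract A D x"
  proof (cases "retract A D x")
    case None
    then show ?thesis by (simp add: ptrans_mult_apply)
  next
    case (Some a)
    then have "a \<in> A"
      using ran_retract[OF assms] by (blast intro: ranI)
    then show ?thesis
      using Some assms(2) retract_fixes by (auto simp: ptrans_mult_apply)
  qed
qed

lemma idem_fixes_ran:
  assumes "ptrans_mult e e = e" "a \<in> ran e"
  shows "e a = Some a"
proof -
  obtain x where "e x = Some a"
    using assms(2) by (auto simp: ran_def)
  then show ?thesis
    using fun_cong[OF assms(1), of x] by (simp add: ptrans_mult_apply)
qed

text \<open>Let \<open>e\<close> send \<open>x\<close> to \<open>v\<close>. Any image point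
  \<open>b \<le> x\<close> is fixed, so isotonicity gives \<open>b \<le> v\<close>; since
  \<open>v \<le> x\<close> also lies in the image, \<open>v\<close> is the largest image point below
  \<open>x\<close>. Fixing the image is the form of idempotency that the generation argument
  supplies.\<close>

lemma idem_eq_retract:
  assumes e: "e \<in> SS n" and fixes_ran: "\<And>a. a \<in> ran e \<Longrightarrow> e a = Some a"
  shows "e = retract (ran e) (dom e)"
proof
  fix x
  show "e x = retract (ran e) (dom e) x"
  proof (cases "e x")
    case None
    then show ?thesis by (auto simp: retract_def)
  next
    case (Some v)
    have "retract (ran e) (dom e) x = Some v"
    proof (rule retract_eq_SomeI)
      show "x \<in> dom e" "v \<in> ran e" "v \<le> x"
        using Some SS_bounds[OF e Some] by (auto intro: ranI)
      show "b \<le> v" if "b \<in> ran e" "b \<le> x" for b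
        using SS_mono[OF e fixes_ran[OF that(1)] Some that(2)] .
    qed
    then show ?thesis using Some by simp
  qed
qed

lemma ran_dom_SS:
  assumes e: "e \<in> SS n" and fixes_ran: "\<And>a. a \<in> ran e \<Longrightarrow> e a = Some a"
  shows "1 \<in> ran e" "ran e \<subseteq> dom e" "dom e \<subseteq> {1..n}"
  using SS_one[OF e] fixes_ran e by (auto intro: ranI simp: SS_def)

lemma retract_rank_layer:
  assumes "(A, D) \<in> retract_pairs n p"
  shows "retract A D \<in> rank_layer n p"
  using assms retract_SS[of A D n] ran_retract[of A D n]
  by (auto simp: retract_pairs_def rank_layer_def)

lemma idem_rank_layer_eq:
  "{e \<in> rank_layer n p. ptrans_mult e e = e} = (\<lambda>(A, D). retract A D) ` retract_pairs n p"
proof (intro equalityI subsetI)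
  fix e assume "e \<in> {e \<in> rank_layer n p. ptrans_mult e e = e}"
  then have e: "e \<in> SS n" "card (ran e) = p" and idem: "ptrans_mult e e = e"
    by (auto simp: rank_layer_def)
  note fr = idem_fixes_ran[OF idem]
  have "(ran e, dom e) \<in> retract_pairs n p"
    using ran_dom_SS[OF e(1) fr] e(2) by (auto simp: retract_pairs_def)
  then show "e \<in> (\<lambda>(A, D). retract A D) ` retract_pairs n p"
    using idem_eq_retract[OF e(1) fr] by (intro image_eqI[of _ _ "(ran e, dom e)"]) auto
next
  fix e assume "e \<in> (\<lambda>(A, D). retract A D) ` retract_pairs n p"
  then obtain A D where AD: "(A, D) \<in> retract_pairs n p" and e: "e = retract A D"
    by auto
  show "e \<in> {e \<in> rank_layer n p. ptrans_mult e e = e}"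
    using retract_rank_layer[OF AD] AD retract_idem[of A D n] unfolding e
    by (auto simp: retract_pairs_def)
qed

section \<open>Counting the idempotents of a layer\<close>

lemma inj_on_retract: "inj_on (\<lambda>(A, D). retract A D) (retract_pairs n p)"
proof (rule inj_onI, clarify)
  fix A D A' D'
  assume P: "(A, D) \<in> retract_pairs n p" "(A', D') \<in> retract_pairs n p"
    and eq: "retract A D = retract A' D'"
  have "D = D'"
    using eq dom_retract by metis
  moreover have "ran (retract A D) = A" "ran (retract A' D') = A'"
    using P ran_retract[of A D n] ran_retract[of A' D' n] by (simp_all add: retract_pairs_def)
  ultimately show "A = A' \<and> D = D'"
    using eq by metis
qed

text \<open>The point 1 is forced into \<open>A\<close>, so the other \<open>p - 1\<close> points
  are chosen from \<open>{2..n}\<close>. Then \<open>D\<close> is \<open>A\<close> together with any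
  subset of the remaining \<open>n - p\<close> points.\<close>

lemma card_retract_pairs:
  assumes "1 \<le> p" "p \<le> n"
  shows "card (retract_pairs n p) = (n - 1 choose (p - 1)) * 2 ^ (n - p)"
proof -
  let ?As = "{A. 1 \<in> A \<and> A \<subseteq> {1..n} \<and> card A = p}"
  have domains: "card {D. A \<subseteq> D \<and> D \<subseteq> {1..n}} = 2 ^ (n - p)" if A: "A \<in> ?As" for A
  proof -
    have "bij_betw (\<lambda>B. A \<union> B) (Pow ({1..n} - A)) {D. A \<subseteq> D \<and> D \<subseteq> {1..n}}"
      by (rule bij_betw_byWitness[where f' = "\<lambda>D. D - A"]) (use A in auto)
    then have "card {D. A \<subseteq> D \<and> D \<subseteq> {1..n}} = card (Pow ({1..n} - A))"
      by (metis bij_betw_same_card)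
    moreover have "card ({1..n} - A) = n - p"
      using A by (subst card_Diff_subset) (auto intro: finite_subset)
    ultimately show ?thesis
      by (simp add: card_Pow)
  qed
  have "bij_betw (insert 1) {B. B \<subseteq> {2..n} \<and> card B = p - 1} ?As"
  proof (rule bij_betw_byWitness[where f' = "\<lambda>A. A - {1}"])
    show "\<forall>B \<in> {B. B \<subseteq> {2..n} \<and> card B = p - 1}. insert 1 B - {1} = B"
      by auto
    show "\<forall>A \<in> ?As. insert 1 (A - {1}) = A"
      by auto
    show "insert 1 ` {B. B \<subseteq> {2..n} \<and> card B = p - 1} \<subseteq> ?As"
    proof clarify
      fix B :: "nat set" assume B: "B \<subseteq> {2..n}" "card B = p - 1"
      have "finite B" "1 \<notin> B"
        using B finite_subset by auto
      then show "1 \<in> insert 1 B \<and> insert 1 B \<subseteq> {1..n} \<and> card (insert 1 B) = p"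
        using B assms by auto
    qed
    show "(\<lambda>A. A - {1}) ` ?As \<subseteq> {B. B \<subseteq> {2..n} \<and> card B = p - 1}"
    proof clarify
      fix A :: "nat set" assume A: "1 \<in> A" "A \<subseteq> {1..n}" "p = card A"
      have "x \<in> {2..n}" if "x \<in> A - {1}" for x
      proof -
        have "x \<noteq> 1" "1 \<le> x" "x \<le> n" using that A by auto
        then show ?thesis by auto
      qed
      then show "A - {1} \<subseteq> {2..n} \<and> card (A - {1}) = card A - 1"
        using A by auto
    qed
  qed
  then have "card ?As = card {B. B \<subseteq> {2..n} \<and> card B = p - 1}"
    by (simp add: bij_betw_same_card)
  also have "\<dots> = (n - 1 choose (p - 1))"
    using n_subsets[of "{2..n}" "p - 1"] by simp
  finally have images: "card ?As = (n - 1 choose (p - 1))" .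
  have "finite ?As"
    by (rule finite_subset[of _ "Pow {1..n}"]) auto
  moreover have "finite {D. A \<subseteq> D \<and> D \<subseteq> {1..n}}" for A
    by (rule finite_subset[of _ "Pow {1..n}"]) auto
  ultimately have "card (retract_pairs n p) = (\<Sum>A\<in>?As. card {D. A \<subseteq> D \<and> D \<subseteq> {1..n}})"
    unfolding retract_pairs_def by (simp add: card_SigmaI)
  also have "\<dots> = card ?As * 2 ^ (n - p)"
    using domains by simp
  finally show ?thesis
    using images by simp
qed

section \<open>The Rees quotient\<close>

text \<open>For \<open>1 \<le> p\<close> the number \<open>p - 1\<close> is a true predecessor, so
  removing the smaller ideal leaves exactly the maps with image of size \<open>p\<close>.\<close>

lemma RSS_eq:
  assumes "1 \<le> p"
  shows "RSS n p = insert Zero (Nonzero ` rank_layer n p)"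
proof -
  have "M n p - M n (p - 1) = rank_layer n p"
    using assms by (auto simp: M_def rank_layer_def)
  then show ?thesis
    by (simp add: RSS_def rees_quotient_def)
qed

text \<open>The image of the product lies in that of \<open>\<beta>\<close>, hence has at most
  \<open>p\<close> points; a product outside the smaller ideal therefore has exactly
  \<open>p\<close>.\<close>

lemma RSS_mult_Nonzero:
  assumes "1 \<le> p" "\<alpha> \<in> rank_layer n p" "\<beta> \<in> rank_layer n p"
  shows "RSS_mult n p (Nonzero \<alpha>) (Nonzero \<beta>) =
    (if ptrans_mult \<alpha> \<beta> \<in> rank_layer n p then Nonzero (ptrans_mult \<alpha> \<beta>) else Zero)"
proof -
  have ab: "\<alpha> \<in> SS n" "\<beta> \<in> SS n" "card (ran \<beta>) = p"
    using assms by (auto simp: rank_layer_def)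
  have "card (ran (ptrans_mult \<alpha> \<beta>)) \<le> p"
    using card_mono[OF finite_ran_SS[OF ab(2)] ran_ptrans_mult_subset[of \<alpha> \<beta>]] ab(3) by simp
  then show ?thesis
    using ptrans_mult_SS[OF ab(1,2)] assms(1) by (auto simp: RSS_mult_def M_def rank_layer_def)
qed

lemma RSS_mult_closed:
  assumes "1 \<le> p" "s \<in> RSS n p" "t \<in> RSS n p"
  shows "RSS_mult n p s t \<in> RSS n p"
  using assms RSS_mult_Nonzero[OF assms(1)]
  by (auto simp: RSS_eq RSS_mult_def)

section \<open>Nonzero idempotents lie in every generating set\<close>

lemma idempotents_RSS:
  assumes "1 \<le> p"
  shows "idempotents (RSS_mult n p) (RSS n p) - {Zero} =
    Nonzero ` {e \<in> rank_layer n p. ptrans_mult e e = e}"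
  using assms RSS_mult_Nonzero[OF assms]
  by (auto simp: RSS_eq idempotents_def split: if_splits)

text \<open>The part of \<open>ran \<beta>\<close> where \<open>\<gamma>\<close> is defined is
  mapped onto a set containing \<open>ran e\<close>. As \<open>ran \<beta>\<close> and
  \<open>ran e\<close> both have \<open>p\<close> points, \<open>\<gamma>\<close> is defined and
  injective on all of \<open>ran \<beta>\<close>; this transfers domain and kernel from
  \<open>e\<close> to \<open>\<beta>\<close>.\<close>

lemma idem_left_factor:
  assumes e: "ptrans_mult \<beta> \<gamma> = e" "ptrans_mult e e = e" "e \<in> rank_layer n p"
    and b: "\<beta> \<in> rank_layer n p" and c: "\<gamma> \<in> rank_layer n p"
  shows "\<beta> = e"
proof -
  have bS: "\<beta> \<in> SS n" and cS: "\<gamma> \<in> SS n" and crb: "card (ran \<beta>) = p" and cre: "card (ran e) = p"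
    using b c e by (auto simp: rank_layer_def)
  let ?R = "{u \<in> ran \<beta>. \<gamma> u \<noteq> None}"
  have finb: "finite (ran \<beta>)"
    using finite_ran_SS[OF bS] .
  have "ran e \<subseteq> (the \<circ> \<gamma>) ` ?R"
  proof
    fix v assume "v \<in> ran e"
    then obtain x where "ptrans_mult \<beta> \<gamma> x = Some v"
      using e(1) by (auto simp: ran_def)
    then obtain u where u: "\<beta> x = Some u" "\<gamma> u = Some v"
      by (rule ptrans_mult_SomeE)
    then show "v \<in> (the \<circ> \<gamma>) ` ?R"
      by (intro image_eqI[of _ _ u]) (auto intro: ranI)
  qed
  then have 1: "p \<le> card ((the \<circ> \<gamma>) ` ?R)"
    using finb cre card_mono[of "(the \<circ> \<gamma>) ` ?R" "ran e"] by auto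
  have 2: "card ((the \<circ> \<gamma>) ` ?R) \<le> card ?R"
    using finb by (intro card_image_le) auto
  have 3: "card ?R \<le> p"
    using finb crb card_mono[of "ran \<beta>" ?R] by auto
  \<comment> \<open>The chain of inequalities 1, 2, 3 starts and ends at \<open>p\<close>, so all of
    them are equalities.\<close>
  have R: "?R = ran \<beta>"
    using 1 2 3 finb crb by (intro card_subset_eq) auto
  have inj: "inj_on (the \<circ> \<gamma>) (ran \<beta>)"
    using 1 2 3 finb R by (intro eq_card_imp_inj_on) auto
  show ?thesis
  proof
    fix z
    show "\<beta> z = e z"
    proof (cases "e z")
      case None
      have "\<beta> z = None"
      proof (rule ccontr)
        assume "\<beta> z \<noteq> None"
        then obtain u where u: "\<beta> z = Some u" by blast
        then have "\<gamma> u \<noteq> None"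
          using R by (blast intro: ranI)
        then show False
          using u None e(1) by (auto simp: ptrans_mult_apply)
      qed
      then show ?thesis using None by simp
    next
      case (Some a)
      then have "e a = Some a"
        using idem_fixes_ran[OF e(2)] by (blast intro: ranI)
      then obtain u where u: "\<beta> a = Some u" "\<gamma> u = Some a"
        using e(1) by (metis ptrans_mult_SomeE)
      \<comment> \<open>Both factors decrease: \<open>\<gamma>\<close> gives
        \<open>a \<le> u\<close> and \<open>\<beta>\<close> gives \<open>u \<le> a\<close>.\<close>
      have "u = a"
        using SS_bounds[OF bS u(1)] SS_bounds[OF cS u(2)] by simp
      obtain w where w: "\<beta> z = Some w" "\<gamma> w = Some a"
        using Some e(1) by (metis ptrans_mult_SomeE)
      have "w = u"
        using inj_onD[OF inj, of w u] u w by (auto intro: ranI)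
      then show ?thesis
        using Some w \<open>u = a\<close> by simp
    qed
  qed
qed

text \<open>Induction on generation: when a product is a nonzero idempotent, its left factor is that
  same idempotent, so the induction hypothesis for the left factor suffices.\<close>

lemma idempotents_in_generators:
  assumes p: "1 \<le> p" and A: "A \<subseteq> RSS n p"
    and gen: "subsemigroup_generated (RSS_mult n p) A = RSS n p"
  shows "idempotents (RSS_mult n p) (RSS n p) - {Zero} \<subseteq> A"
proof -
  have "s \<in> idempotents (RSS_mult n p) (RSS n p) - {Zero} \<Longrightarrow> s \<in> A"
    if "s \<in> subsemigroup_generated (RSS_mult n p) A" for s
    using that
  proof induction
    case (base a)
    then show ?case by blast
  next
    case (mult x y)
    obtain e where e: "RSS_mult n p x y = Nonzero e" "e \<in> rank_layer n p" "ptrans_mult e e = e"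
      using mult.prems unfolding idempotents_RSS[OF p] by auto
    have "x \<in> RSS n p" "y \<in> RSS n p"
      using mult.hyps gen by auto
    moreover have "x \<noteq> Zero" "y \<noteq> Zero"
      using e(1) by (cases x; auto simp: RSS_mult_def)+
    ultimately obtain \<beta> \<gamma> where xy: "x = Nonzero \<beta>" "y = Nonzero \<gamma>"
      and bc: "\<beta> \<in> rank_layer n p" "\<gamma> \<in> rank_layer n p"
      unfolding RSS_eq[OF p] by auto
    have "ptrans_mult \<beta> \<gamma> = e"
      using e(1) RSS_mult_Nonzero[OF p bc] unfolding xy by (auto split: if_splits)
    then have "\<beta> = e"
      using idem_left_factor e(2,3) bc by blast
    then show ?case
      using mult.IH(1) mult.prems e(1) xy by simp
  qed
  then show ?thesis
    using gen by (auto simp: idempotents_def)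
qed

section \<open>The idempotents generate\<close>

text \<open>The first retraction sends each point to the minimum of its kernel class, the second
  moves only the least non-fixed minimum \<open>x\<close> to its value \<open>y < x\<close>, and
  \<open>\<beta>\<close> does the rest. The domain of \<open>\<beta>\<close> is the set of minima
  with \<open>x\<close> replaced by \<open>y\<close>, whence the smaller sum.\<close>

lemma SS_factorization:
  assumes al: "\<alpha> \<in> SS n" and nonfix: "\<exists>a\<in>ran \<alpha>. \<alpha> a \<noteq> Some a"
  obtains A A' D' \<beta> where
    "(A, dom \<alpha>) \<in> retract_pairs n (card (ran \<alpha>))"
    "(A', D') \<in> retract_pairs n (card (ran \<alpha>))"
    "\<beta> \<in> SS n" "ran \<beta> = ran \<alpha>" "\<Sum>(dom \<beta>) < \<Sum>(dom \<alpha>)"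
    "\<alpha> = ptrans_mult (ptrans_mult (retract A (dom \<alpha>)) (retract A' D')) \<beta>"
proof -
  let ?D = "dom \<alpha>"
  \<comment> \<open>The minima of the kernel classes: a transversal of the kernel, so
    \<open>A\<close> has as many points as \<open>ran \<alpha>\<close>.\<close>
  define A where "A = {a \<in> ?D. \<forall>b. \<alpha> b = \<alpha> a \<longrightarrow> a \<le> b}"
  have AD: "A \<subseteq> ?D"
    by (auto simp: A_def)
  have Dn: "?D \<subseteq> {1..n}"
    using al by (simp add: SS_def)
  have finD: "finite ?D"
    using finite_dom_SS[OF al] .
  then have finA: "finite A"
    using AD finite_subset by blast
  have one: "1 \<in> A"
    using SS_one[OF al] SS_bounds[OF al] unfolding A_def
    by (auto simp: dom_def intro: order_trans)
  have A_inj: "a = b" if "a \<in> A" "b \<in> A" "\<alpha> a = \<alpha> b" for a b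
    using that unfolding A_def by (auto intro: le_antisym)
  have rep: "\<exists>a\<in>A. a \<le> z \<and> \<alpha> a = \<alpha> z" if "z \<in> ?D" for z
  proof (intro bexI conjI)
    let ?a = "LEAST w. \<alpha> w = \<alpha> z"
    show "?a \<le> z" by (rule Least_le) simp
    show eq: "\<alpha> ?a = \<alpha> z" by (rule LeastI[of _ z]) simp
    show "?a \<in> A"
      using that eq unfolding A_def by (auto simp: dom_def intro: Least_le)
  qed
  have "ran \<alpha> = (the \<circ> \<alpha>) ` A"
  proof (intro equalityI subsetI)
    fix v assume "v \<in> ran \<alpha>"
    then obtain z where z: "\<alpha> z = Some v" by (auto simp: ran_def)
    then obtain a where "a \<in> A" "\<alpha> a = Some v"
      using rep[of z] by auto
    then show "v \<in> (the \<circ> \<alpha>) ` A"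
      by (intro image_eqI[of _ _ a]) auto
  next
    fix v assume "v \<in> (the \<circ> \<alpha>) ` A"
    then show "v \<in> ran \<alpha>"
      using AD by (force simp: ran_def)
  qed
  moreover have "inj_on (the \<circ> \<alpha>) A"
    using A_inj AD by (intro inj_onI) (metis comp_apply domIff option.expand subsetD)
  ultimately have cardA: "card (ran \<alpha>) = card A"
    by (metis card_image)
  define P where "P = (\<lambda>x. x \<in> A \<and> \<alpha> x \<noteq> Some x)"
  \<comment> \<open>The minimum \<open>a\<close> of the class sent to a non-fixed image point
    \<open>v\<close> is not fixed, since otherwise \<open>a = v\<close>.\<close>
  have "\<exists>x. P x"
  proof -
    obtain v where v: "v \<in> ran \<alpha>" "\<alpha> v \<noteq> Some v"
      using nonfix by blast
    then obtain z where z: "\<alpha> z = Some v" by (auto simp: ran_def)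
    obtain a where a: "a \<in> A" "\<alpha> a = Some v"
      using rep[of z] z by auto
    then show ?thesis
      using v(2) unfolding P_def by auto
  qed
  define x where "x = (LEAST x. P x)"
  have "P x"
    unfolding x_def using \<open>\<exists>x. P x\<close> by (rule LeastI_ex)
  then have xA: "x \<in> A" and xne: "\<alpha> x \<noteq> Some x"
    by (auto simp: P_def)
  have below: "\<alpha> a = Some a" if "a \<in> A" "a < x" for a
    using not_less_Least[of a P] that unfolding x_def P_def by blast
  obtain y where y: "\<alpha> x = Some y"
    using xA AD by blast
  have yx: "y < x"
    using SS_bounds[OF al y] xne y by (metis le_neq_implies_less)
  have y1: "1 \<le> y" and xn: "x \<le> n"
    using SS_bounds[OF al y] by auto
  \<comment> \<open>Minima below \<open>x\<close> are fixed by the choice of \<open>x\<close>, so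
    isotonicity compares them with \<open>y\<close>.\<close>
  have below_y: "a \<le> y" if "a \<in> A" "a < x" for a
    using SS_mono[OF al below[OF that] y] that by simp
  \<comment> \<open>Were \<open>y\<close> in \<open>A\<close>, it would be fixed and so share its
    value \<open>y\<close> with \<open>x\<close>, putting two minima into one class.\<close>
  have yA: "y \<notin> A"
    using below[of y] A_inj[OF _ xA, of y] y yx by auto
  define A' where "A' = insert y (A - {x})"
  \<comment> \<open>Keeping \<open>x\<close> in the domain but not in the image \<open>A'\<close>
    makes the second retraction move it down to \<open>y\<close>.\<close>
  define D' where "D' = insert y A"
  \<comment> \<open>The value at \<open>y\<close> is prescribed separately, because
    \<open>\<alpha>\<close> may be undefined at \<open>y\<close> or send it lower.\<close>
  define \<beta> where "\<beta> = (\<lambda>z. if z = y then Some y else if z \<in> A - {x} then \<alpha> z else None)"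
  have x1: "x \<noteq> 1"
    using y1 yx by simp
  have pair1: "(A, ?D) \<in> retract_pairs n (card (ran \<alpha>))"
    unfolding retract_pairs_def using one AD Dn cardA by auto
  have D'n: "D' \<subseteq> {1..n}"
    unfolding D'_def using AD Dn y1 xn yx by auto
  have A'D': "A' \<subseteq> D'"
    by (auto simp: A'_def D'_def)
  have one': "1 \<in> A'"
    using one x1 by (auto simp: A'_def)
  have "card A' = card A"
    unfolding A'_def using finA xA yA by (simp add: card_Suc_Diff1 del: card_Diff_insert card_Diff_singleton)
  then have pair2: "(A', D') \<in> retract_pairs n (card (ran \<alpha>))"
    unfolding retract_pairs_def using one' A'D' D'n cardA by auto
  have dom_beta: "dom \<beta> = A'"
    unfolding \<beta>_def A'_def using AD by (auto simp: dom_def)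
  have betaS: "\<beta> \<in> SS n"
    unfolding SS_iff
  proof (intro conjI allI impI)
    fix z v assume "\<beta> z = Some v"
    then have "z = y \<and> v = y \<or> \<alpha> z = Some v"
      by (auto simp: \<beta>_def split: if_splits)
    then show "1 \<le> v" "v \<le> z" "z \<le> n"
      using SS_bounds[OF al] y1 yx xn by auto
  next
    fix z z' v v' assume z: "\<beta> z = Some v" and z': "\<beta> z' = Some v'" and le: "z \<le> z'"
    have cases: "u = y \<and> w = y \<or> u \<in> A \<and> u \<noteq> x \<and> \<alpha> u = Some w" if "\<beta> u = Some w" for u w
      using that by (auto simp: \<beta>_def split: if_splits)
    consider "z = y" "v = y" "z' = y" "v' = y"
      | "z = y" "v = y" "z' \<in> A" "z' \<noteq> x" "\<alpha> z' = Some v'"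
      | "z \<in> A" "z \<noteq> x" "\<alpha> z = Some v" "z' = y" "v' = y"
      | "\<alpha> z = Some v" "\<alpha> z' = Some v'"
      using cases[OF z] cases[OF z'] by blast
    then show "v \<le> v'"
    proof cases
      case 2
      \<comment> \<open>A minimum \<open>z' < x\<close> would satisfy \<open>z' \<le> y\<close>,
        hence equal \<open>y\<close>, which is not in \<open>A\<close>. So
        \<open>x \<le> z'\<close>, and isotonicity of \<open>\<alpha>\<close> applies.\<close>
      have "\<not> z' < x"
        using below_y[OF 2(3)] 2 le yA by (metis le_antisym)
      then show ?thesis
        using SS_mono[OF al y 2(5)] 2 by simp
    next
      case 3
      then show ?thesis
        using SS_bounds[OF al 3(3)] le by simp
    qed (use SS_mono[OF al _ _ le] in auto)
  next
    show "\<beta> 1 = Some 1"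
      using SS_one[OF al] one x1 by (auto simp: \<beta>_def)
  qed
  have eq: "\<alpha> = ptrans_mult (ptrans_mult (retract A ?D) (retract A' D')) \<beta>"
  proof (rule ext[OF sym])
    fix z
    show "ptrans_mult (ptrans_mult (retract A ?D) (retract A' D')) \<beta> z = \<alpha> z"
    proof (cases "z \<in> ?D")
      case False
      then show ?thesis
        by (auto simp: ptrans_mult_apply retract_def dom_def)
    next
      case True
      obtain a where a: "a \<in> A" "a \<le> z" "\<alpha> a = \<alpha> z"
        using rep[OF True] by blast
      have 1: "retract A ?D z = Some a"
      proof (rule retract_eq_SomeI[OF True a(1,2)])
        \<comment> \<open>A minimum \<open>b\<close> with \<open>a < b \<le> z\<close> would be
          squeezed into the kernel class of \<open>a\<close> and \<open>z\<close>, contradicting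
          that \<open>A\<close> is a transversal.\<close>
        fix b assume b: "b \<in> A" "b \<le> z"
        show "b \<le> a"
        proof (rule ccontr)
          assume "\<not> b \<le> a"
          obtain v where v: "\<alpha> z = Some v" using True by blast
          obtain w where w: "\<alpha> b = Some w" using b AD by blast
          have "w = v"
            using SS_mono[OF al _ w, of a v] SS_mono[OF al w v b(2)] v a(3) \<open>\<not> b \<le> a\<close> by simp
          then show False
            using A_inj[OF b(1) a(1)] w v a(3) \<open>\<not> b \<le> a\<close> by simp
        qed
      qed
      show ?thesis
      proof (cases "a = x")
        case True
        \<comment> \<open>The points of \<open>A'\<close> up to \<open>x\<close> are
          \<open>y\<close> and minima below \<open>x\<close>, all at most \<open>y\<close>.\<close>
        have "retract A' D' x = Some y"
          using below_y yx xA
          by (intro retract_eq_SomeI) (auto simp: A'_def D'_def)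
        then show ?thesis
          using 1 True a(3)[symmetric] y by (simp add: ptrans_mult_apply \<beta>_def)
      next
        case False
        then have "retract A' D' a = Some a"
          using a(1) by (intro retract_fixes) (auto simp: A'_def D'_def)
        moreover have "a \<noteq> y" using a(1) yA by blast
        ultimately show ?thesis
          using 1 False a by (simp add: ptrans_mult_apply \<beta>_def)
      qed
    qed
  qed
  have ran_beta: "ran \<beta> = ran \<alpha>"
  proof
    show "ran \<beta> \<subseteq> ran \<alpha>"
      using y by (auto simp: ran_def \<beta>_def)
    show "ran \<alpha> \<subseteq> ran \<beta>"
      by (subst eq) (rule ran_ptrans_mult_subset)
  qed
  have "\<Sum>(dom \<beta>) = y + \<Sum>(A - {x})"
    unfolding dom_beta A'_def using finA yA by simp
  also have "\<dots> < x + \<Sum>(A - {x})"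
    using yx by simp
  also have "\<dots> = \<Sum>A"
    using sum.remove[OF finA xA, of "\<lambda>a. a"] by simp
  also have "\<dots> \<le> \<Sum>?D"
    using AD finD by (intro sum_mono2) auto
  finally have "\<Sum>(dom \<beta>) < \<Sum>?D" .
  then show thesis
    by (rule that[OF pair1 pair2 betaS ran_beta _ eq])
qed

text \<open>Strong induction on the sum of the domain. A map fixing its image is itself a
  retraction; any other map factors into two retractions and a map of smaller sum in the same
  layer.\<close>

lemma rank_layer_generated:
  assumes p: "1 \<le> p" and "\<alpha> \<in> rank_layer n p"
  shows "Nonzero \<alpha> \<in> subsemigroup_generated (RSS_mult n p)
    (idempotents (RSS_mult n p) (RSS n p) - {Zero})" (is "_ \<in> ?G")
  using assms(2)
proof (induction "\<Sum>(dom \<alpha>)" arbitrary: \<alpha> rule: less_induct)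
  case less
  have retr: "Nonzero (retract A D) \<in> ?G" if "(A, D) \<in> retract_pairs n p" for A D
    unfolding idempotents_RSS[OF p] idem_rank_layer_eq
    using that by (intro subsemigroup_generated.base) auto
  have al: "\<alpha> \<in> SS n" "card (ran \<alpha>) = p"
    using less.prems by (auto simp: rank_layer_def)
  show ?case
  proof (cases "\<exists>a\<in>ran \<alpha>. \<alpha> a \<noteq> Some a")
    case False
    then have fr: "\<And>a. a \<in> ran \<alpha> \<Longrightarrow> \<alpha> a = Some a" by blast
    have "(ran \<alpha>, dom \<alpha>) \<in> retract_pairs n p"
      using ran_dom_SS[OF al(1) fr] al(2) by (auto simp: retract_pairs_def)
    then show ?thesis
      using retr idem_eq_retract[OF al(1) fr] by metis
  next
    case True
    obtain A A' D' \<beta> where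
      pairs: "(A, dom \<alpha>) \<in> retract_pairs n p" "(A', D') \<in> retract_pairs n p"
      and beta: "\<beta> \<in> SS n" "ran \<beta> = ran \<alpha>" "\<Sum>(dom \<beta>) < \<Sum>(dom \<alpha>)"
      and eq: "\<alpha> = ptrans_mult (ptrans_mult (retract A (dom \<alpha>)) (retract A' D')) \<beta>"
      by (rule SS_factorization[OF al(1) True, unfolded al(2)])
    let ?e = "retract A (dom \<alpha>)" and ?f = "retract A' D'"
    have bL: "\<beta> \<in> rank_layer n p"
      using beta al by (simp add: rank_layer_def)
    have eL: "?e \<in> rank_layer n p" and fL: "?f \<in> rank_layer n p"
      using retract_rank_layer pairs by auto
    then have S: "?e \<in> SS n" "?f \<in> SS n"
      by (auto simp: rank_layer_def)
    \<comment> \<open>Rebracketing exhibits \<open>ran \<alpha>\<close> inside the image of the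
      right-hand partial product, which in turn lies in \<open>ran \<beta> = ran \<alpha>\<close>.
      So the partial product keeps \<open>p\<close> image points and does not collapse to
      \<open>Zero\<close>.\<close>
    have assoc: "\<alpha> = ptrans_mult ?e (ptrans_mult ?f \<beta>)"
      by (subst eq) (auto simp: ptrans_mult_apply fun_eq_iff split: option.splits)
    have "ran \<alpha> \<subseteq> ran (ptrans_mult ?f \<beta>)"
      by (subst assoc) (rule ran_ptrans_mult_subset)
    then have "ran (ptrans_mult ?f \<beta>) = ran \<alpha>"
      using ran_ptrans_mult_subset[of ?f \<beta>] beta(2) by auto
    then have fbL: "ptrans_mult ?f \<beta> \<in> rank_layer n p"
      using ptrans_mult_SS[OF S(2) beta(1)] al(2) by (simp add: rank_layer_def)
    have "RSS_mult n p (Nonzero ?f) (Nonzero \<beta>) = Nonzero (ptrans_mult ?f \<beta>)"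
      using RSS_mult_Nonzero[OF p fL bL] fbL by simp
    then have "Nonzero (ptrans_mult ?f \<beta>) \<in> ?G"
      using subsemigroup_generated.mult[OF retr[OF pairs(2)] less.hyps[OF beta(3) bL]] by simp
    moreover have "RSS_mult n p (Nonzero ?e) (Nonzero (ptrans_mult ?f \<beta>)) = Nonzero \<alpha>"
      using RSS_mult_Nonzero[OF p eL fbL] less.prems assoc[symmetric] by simp
    ultimately show ?thesis
      using subsemigroup_generated.mult[OF retr[OF pairs(1)]] by metis
  qed
qed

text \<open>For \<open>p < n\<close>, the partial identities on two different \<open>p\<close>-sets multiply to zero.\<close>

lemma Zero_generated:
  assumes p: "2 \<le> p" and "p < n"
  shows "Zero \<in> subsemigroup_generated (RSS_mult n p)
    (idempotents (RSS_mult n p) (RSS n p) - {Zero})" (is "_ \<in> ?G")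
proof -
  have p1: "1 \<le> p" using p by simp
  define A where "A = {1..p}"
  \<comment> \<open>Exchanging \<open>p\<close> for \<open>Suc p\<close> stays within
    \<open>{1..n}\<close> because \<open>p < n\<close>, and keeps 1 because
    \<open>2 \<le> p\<close>; only \<open>p - 1\<close> points are shared with
    \<open>A\<close>.\<close>
  define B where "B = insert (Suc p) {1..p - 1}"
  have pairs: "(A, A) \<in> retract_pairs n p" "(B, B) \<in> retract_pairs n p"
    using assms by (auto simp: retract_pairs_def A_def B_def)
  have retr: "Nonzero (retract A D) \<in> ?G" if "(A, D) \<in> retract_pairs n p" for A D
    unfolding idempotents_RSS[OF p1] idem_rank_layer_eq
    using that by (intro subsemigroup_generated.base) auto
  let ?g = "ptrans_mult (retract A A) (retract B B)"
  have id: "retract C C z = (if z \<in> C then Some z else None)" for C z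
    using retract_fixes[of z C C] by (simp add: retract_def)
  have "ran ?g \<subseteq> {1..p - 1}"
    by (auto simp: ran_def ptrans_mult_apply id A_def B_def split: if_splits)
  then have "card (ran ?g) \<le> p - 1"
    using card_mono[of "{1..p - 1}" "ran ?g"] by simp
  then have "?g \<notin> rank_layer n p"
    using p by (auto simp: rank_layer_def)
  then have "RSS_mult n p (Nonzero (retract A A)) (Nonzero (retract B B)) = Zero"
    using RSS_mult_Nonzero[OF p1 retract_rank_layer[OF pairs(1)] retract_rank_layer[OF pairs(2)]]
    by simp
  then show ?thesis
    using subsemigroup_generated.mult[OF retr[OF pairs(1)] retr[OF pairs(2)]] by simp
qed

section \<open>Generated subsemigroups and minimal cardinalities\<close>

lemma subsemigroup_generated_closed:
  assumes "A \<subseteq> S" "\<And>x y. x \<in> S \<Longrightarrow> y \<in> S \<Longrightarrow> mult x y \<in> S"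
  shows "subsemigroup_generated mult A \<subseteq> S"
proof
  fix s assume "s \<in> subsemigroup_generated mult A"
  then show "s \<in> S"
    by induction (use assms in auto)
qed

lemma subsemigroup_generated_mono:
  assumes "A \<subseteq> B"
  shows "subsemigroup_generated mult A \<subseteq> subsemigroup_generated mult B"
proof
  fix s assume "s \<in> subsemigroup_generated mult A"
  then show "s \<in> subsemigroup_generated mult B"
    by induction (use assms in \<open>auto intro: subsemigroup_generated.intros\<close>)
qed

text \<open>A member of the family contained in all finite members attains the minimum; this form
  serves all four rank invariants.\<close>

lemma INF_card_least:
  assumes "E \<in> F" "\<And>A. A \<in> F \<Longrightarrow> finite A \<and> E \<subseteq> A"
  shows "(INF A\<in>F. enat (card A)) = enat (card E)"
  using assms by (intro antisym INF_lower INF_greatest) (auto intro: card_mono)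

theorem theorem3p6:
  fixes n p :: nat
  assumes "2 \<le> p" and "p \<le> n"
  shows "(p < n \<longrightarrow>
            semigroup_rank (RSS_mult n p) (RSS n p) = semigroup_idrank (RSS_mult n p) (RSS n p) \<and>
            semigroup_idrank (RSS_mult n p) (RSS n p)
              = enat (card (idempotents (RSS_mult n p) (RSS n p) - {Zero}))) \<and>
         semigroup0_rank (RSS_mult n p) Zero (RSS n p)
           = semigroup0_idrank (RSS_mult n p) Zero (RSS n p) \<and>
         semigroup0_idrank (RSS_mult n p) Zero (RSS n p)
           = enat (card (idempotents (RSS_mult n p) (RSS n p) - {Zero})) \<and>
         card (idempotents (RSS_mult n p) (RSS n p) - {Zero}) = (n - 1 choose (p - 1)) * 2 ^ (n - p)"
proof -
  have p: "1 \<le> p" using assms by simp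
  let ?S = "RSS n p" and ?m = "RSS_mult n p"
  define E where "E = idempotents ?m ?S - {Zero}"
  have cardE: "card E = (n - 1 choose (p - 1)) * 2 ^ (n - p)"
    unfolding E_def idempotents_RSS[OF p] idem_rank_layer_eq
    using card_retract_pairs[OF p assms(2)] inj_on_retract[of n p]
    by (simp add: card_image inj_on_def)
  \<comment> \<open>The count is positive for \<open>p \<le> n\<close>, whereas an infinite set
    would have \<open>card\<close> 0.\<close>
  have "finite E"
    using cardE assms by (intro card_ge_0_finite) simp
  have idemS: "idempotents ?m ?S \<subseteq> ?S"
    by (auto simp: idempotents_def)
  have ES: "E \<subseteq> ?S" "E \<subseteq> idempotents ?m ?S" and Z: "Zero \<in> ?S"
    using idemS by (auto simp: E_def RSS_eq[OF p])
  have least: "E \<subseteq> A" if "A \<subseteq> ?S" "subsemigroup_generated ?m A = ?S" for A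
    unfolding E_def using idempotents_in_generators[OF p that] .
  have least_id: "E \<subseteq> A"
    if "A \<subseteq> idempotents ?m ?S" "subsemigroup_generated ?m A = ?S" for A
    using least[OF subset_trans[OF that(1) idemS] that(2)] .
  \<comment> \<open>Adjoining \<open>Zero\<close> to \<open>A\<close> gives an ordinary generating
    set, and \<open>E\<close> does not contain \<open>Zero\<close>, so \<open>E\<close> already lies
    in \<open>A\<close>.\<close>
  have least0: "E \<subseteq> A" if "A \<subseteq> ?S" "subsemigroup_generated ?m (insert Zero A) = ?S" for A
    using least[of "insert Zero A"] that Z by (auto simp: E_def)
  have least0_id: "E \<subseteq> A"
    if "A \<subseteq> idempotents ?m ?S" "subsemigroup_generated ?m (insert Zero A) = ?S" for A
    using least0[OF subset_trans[OF that(1) idemS] that(2)] .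
  have sub: "subsemigroup_generated ?m A \<subseteq> ?S" if "A \<subseteq> ?S" for A
    using subsemigroup_generated_closed[OF that] RSS_mult_closed[OF p] by blast
  have layer: "Nonzero ` rank_layer n p \<subseteq> subsemigroup_generated ?m E"
    using rank_layer_generated[OF p] by (auto simp: E_def)
  have gen0: "subsemigroup_generated ?m (insert Zero E) = ?S"
  proof
    show "subsemigroup_generated ?m (insert Zero E) \<subseteq> ?S"
      using sub[of "insert Zero E"] ES Z by simp
    have "Zero \<in> subsemigroup_generated ?m (insert Zero E)"
      by (intro subsemigroup_generated.base) simp
    then show "?S \<subseteq> subsemigroup_generated ?m (insert Zero E)"
      using layer subsemigroup_generated_mono[of E "insert Zero E" ?m]
      unfolding RSS_eq[OF p] by blast
  qed
  \<comment> \<open>Here \<open>Zero\<close> must itself be a product of nonzero idempotents, which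
    is where \<open>p < n\<close> enters.\<close>
  have gen: "subsemigroup_generated ?m E = ?S" if "p < n"
  proof
    show "?S \<subseteq> subsemigroup_generated ?m E"
      using Zero_generated[OF assms(1) that] layer unfolding RSS_eq[OF p] E_def by blast
  qed (use sub ES in simp)
  have "semigroup_rank ?m ?S = enat (card E)" if "p < n"
    unfolding semigroup_rank_def
    by (rule INF_card_least) (use gen[OF that] \<open>finite E\<close> ES least in auto)
  moreover have "semigroup_idrank ?m ?S = enat (card E)" if "p < n"
    unfolding semigroup_idrank_def
    by (rule INF_card_least) (use gen[OF that] \<open>finite E\<close> ES least_id in auto)
  moreover have "semigroup0_rank ?m Zero ?S = enat (card E)"
    unfolding semigroup0_rank_def
    by (rule INF_card_least) (use gen0 \<open>finite E\<close> ES least0 in auto)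
  moreover have "semigroup0_idrank ?m Zero ?S = enat (card E)"
    unfolding semigroup0_idrank_def
    by (rule INF_card_least) (use gen0 \<open>finite E\<close> ES least0_id in auto)
  ultimately show ?thesis
    using cardE unfolding E_def by simp
qed

end
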